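(* Let $X$ be a compact metric space, $T:X\to X$ continuous, and $\mu$ a $T$-invariant ergodic Borel probability measure on $X$. Let $\alpha=\{A_1,\dots,A_r\}$ be a finite measurable partition of $X$ and let $Z$ be an optimal reversible coding algorithm on the alphabet $\{1,\dots,r\}$. Then for $\mu$-almost every $x\in X$, $$K_Z(x,\alpha)=h_\mu(T,\alpha),$$ where $h_\mu(T,\alpha)$ is the Kolmogorov–Sinai entropy of $T$ with respect to $\alpha$.
   Context: The symbolic coding $\varphi_\alpha:X\to\{1,\dots,r\}^{\mathbb{N}}$ is $\varphi_\alpha(x)=\omega$ where $T^j(x)\in A_{\omega_j}$ for all $j\in\mathbb{N}$. $K_Z(x,\alpha)=\limsup_{n\to\infty}|Z(\omega^n)|/n$ with $\omega=\varphi_\alpha(x)$ and $\omega^n$ its first $n$ symbols. Empirical entropy of a finite string $s$ of length $n$: $P(s,w)=\frac{1}{n-l+1}\#\{0\le i\le n-l:s_{i+1}\cdots s_{i+l}=w\}$ for $w$ of length $l$, $\hat H_l(s)=-\frac1l\sum_wP(s,w)\log_2P(s,w)$. A reversible coding algorithm is an injective recursive map $Z$ from finite strings to finite binary strings; it is optimal if for each $k$ there exists $f_k$ with $f_k(n)=o(n)$ such that $|Z(s)|/|s|\le\hat H_k(s)+f_k(|s|)/|s|$ for all finite strings $s$. *)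

theory Defs
  imports "HOL-Probability.Probability" "HOL-Library.Landau_Symbols"
begin

definition words :: "nat \<Rightarrow> nat \<Rightarrow> nat list set" where
  "words r l = {w \<in> lists {1..r}. length w = l}"

definition emp_freq :: "nat list \<Rightarrow> nat list \<Rightarrow> real" where
  "emp_freq s w =
     real (card {i. i \<le> length s - length w \<and> length w \<le> length s \<and>
                   take (length w) (drop i s) = w})
     / (real (length s) - real (length w) + 1)"

definition emp_entropy :: "nat \<Rightarrow> nat \<Rightarrow> nat list \<Rightarrow> real" where
  "emp_entropy r l s =
     - (1 / real l) * (\<Sum>w\<in>words r l. emp_freq s w * log 2 (emp_freq s w))"

definition optimal_coding :: "nat \<Rightarrow> (nat list \<Rightarrow> bool list) \<Rightarrow> bool" where
  "optimal_coding r Z \<longleftrightarrow>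
     inj_on Z (lists {1..r}) \<and>
     (\<forall>k\<ge>1. \<exists>f :: nat \<Rightarrow> real. f \<in> o(\<lambda>n. real n) \<and>
        (\<forall>s\<in>lists {1..r}.
           real (length (Z s)) / real (length s)
             \<le> emp_entropy r k s + f (length s) / real (length s)))"

definition sym_coding :: "('a \<Rightarrow> 'a) \<Rightarrow> (nat \<Rightarrow> 'a set) \<Rightarrow> nat \<Rightarrow> 'a \<Rightarrow> nat \<Rightarrow> nat" where
  "sym_coding T A r x = (\<lambda>j. THE i. i \<in> {1..r} \<and> (T ^^ j) x \<in> A i)"

definition K_Z :: "(nat list \<Rightarrow> bool list) \<Rightarrow> ('a \<Rightarrow> 'a) \<Rightarrow> (nat \<Rightarrow> 'a set) \<Rightarrow> nat \<Rightarrow> 'a \<Rightarrow> ereal" where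
  "K_Z Z T A r x =
     limsup (\<lambda>n. ereal (real (length (Z (map (sym_coding T A r x) [0..<n]))) / real n))"

definition cylinder :: "'a set \<Rightarrow> ('a \<Rightarrow> 'a) \<Rightarrow> (nat \<Rightarrow> 'a set) \<Rightarrow> nat list \<Rightarrow> 'a set" where
  "cylinder X T A w = {x \<in> X. \<forall>j<length w. (T ^^ j) x \<in> A (w ! j)}"

definition part_entropy_n :: "'a measure \<Rightarrow> ('a \<Rightarrow> 'a) \<Rightarrow> (nat \<Rightarrow> 'a set) \<Rightarrow> nat \<Rightarrow> nat \<Rightarrow> real" where
  "part_entropy_n M T A r n =
     - (\<Sum>w\<in>words r n. measure M (cylinder (space M) T A w) * log 2 (measure M (cylinder (space M) T A w)))"

definition KS_entropy :: "'a measure \<Rightarrow> ('a \<Rightarrow> 'a) \<Rightarrow> (nat \<Rightarrow> 'a set) \<Rightarrow> nat \<Rightarrow> real" where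
  "KS_entropy M T A r = lim (\<lambda>n. part_entropy_n M T A r n / real n)"

definition ergodic :: "'a measure \<Rightarrow> ('a \<Rightarrow> 'a) \<Rightarrow> bool" where
  "ergodic M T \<longleftrightarrow> (\<forall>B\<in>sets M. T -` B \<inter> space M = B \<longrightarrow> measure M B = 0 \<or> measure M B = 1)"

end

theory Submission
  imports Defs "HOL-Real_Asymp.Real_Asymp"
begin

text \<open>
  Write \<open>H k\<close> for the entropy of the \<open>k\<close>-cylinders and \<open>L n x\<close> for the coding rate of the first
  \<open>n\<close> symbols of \<open>x\<close>. By Birkhoff's theorem the empirical \<open>k\<close>-block entropies converge almost
  everywhere to \<open>H k / k\<close>, so optimality gives \<open>limsup L n x \<le> H k / k\<close> for every \<open>k\<close>. Conversely,
  as \<open>Z\<close> is injective with codewords of length \<open>O(n)\<close>, Gibbs' inequality gives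
  \<open>H n / n \<le> E (L n) + O(log n / n)\<close>. Since \<open>L n\<close> is uniformly bounded, reverse Fatou yields
  \<open>limsup H n / n \<le> E (limsup L n) \<le> inf H k / k\<close>. Hence \<open>H n / n\<close> converges (subadditivity is not
  needed) and \<open>limsup L n\<close> equals its limit almost everywhere; the lower bound does not require the
  Shannon--McMillan--Breiman theorem.
\<close>

section \<open>The function \<open>x * log 2 x\<close>\<close>

lemma continuous_on_mult_log2: "continuous_on {0..} (\<lambda>x::real. x * log 2 x)"
proof -
  have "((\<lambda>y::real. y * log 2 y) \<longlongrightarrow> x * log 2 x) (at x within {0..})" if "x \<ge> 0" for x
  proof (cases "x = 0")
    case True
    \<comment> \<open>The point 0 needs its own limit, since \<open>log 2\<close> has none there;
      the product takes the value 0, as in the usual convention for entropies.\<close>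
    have "((\<lambda>y::real. y * log 2 y) \<longlongrightarrow> 0) (at_right 0)"
      by real_asymp
    moreover have "at (0::real) within {0..} = at_right 0"
      by (rule at_within_nhd[of _ UNIV]) auto
    ultimately show ?thesis using True by simp
  next
    case False
    then have "((\<lambda>y::real. y * log 2 y) \<longlongrightarrow> x * log 2 x) (at x)"
      using that by (auto intro!: tendsto_intros)
    then show ?thesis
      by (rule tendsto_within_subset) simp
  qed
  then show ?thesis by (simp add: continuous_on_def)
qed

lemma tendsto_mult_log2:
  fixes p :: "nat \<Rightarrow> real"
  assumes "p \<longlonglongrightarrow> q" "\<And>n. p n \<ge> 0"
  shows "(\<lambda>n. p n * log 2 (p n)) \<longlonglongrightarrow> q * log 2 q"
  by (rule continuous_on_tendsto_compose[OF continuous_on_mult_log2 assms(1)])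
     (use assms LIMSEQ_le_const[OF assms(1), of 0] in auto)

text \<open>Apply \<open>ln t \<le> t - 1\<close> at \<open>t = 1 / x\<close>. The bound is crude
  but asks for no upper limit on \<open>x\<close>, so empirical frequencies only have to be
  nonnegative.\<close>

lemma mult_log2_ge:
  fixes x :: real
  assumes "x \<ge> 0"
  shows "x * log 2 x \<ge> - (1 / ln 2)"
proof (cases "x = 0")
  case False
  then have "ln (1 / x) \<le> 1 / x - 1"
    using assms by (intro ln_le_minus_one) auto
  then have "x * ln (1 / x) \<le> x * (1 / x - 1)"
    using assms by (rule mult_left_mono)
  then have "- 1 \<le> x * ln x"
    using False assms by (simp add: ln_div right_diff_distrib)
  then have "- 1 / ln 2 \<le> x * ln x / ln 2"
    by (rule divide_right_mono) simp
  then show ?thesis by (simp add: log_def)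
qed simp

section \<open>Gibbs' inequality and Kraft sums\<close>

text \<open>This is Gibbs' inequality for \<open>p\<close> against the weights
  \<open>(1/2) ^ l w / K\<close>, whose total is at most 1. The term \<open>log 2 K\<close> pays for
  a Kraft sum that may exceed 1.\<close>

lemma entropy_le_mean_length:
  fixes p :: "'w \<Rightarrow> real" and l :: "'w \<Rightarrow> nat"
  assumes "finite W" and p: "\<And>w. w \<in> W \<Longrightarrow> p w \<ge> 0" and p1: "(\<Sum>w\<in>W. p w) = 1"
    and K: "(\<Sum>w\<in>W. (1/2) ^ l w) \<le> K"
  shows "- (\<Sum>w\<in>W. p w * log 2 (p w)) \<le> (\<Sum>w\<in>W. p w * l w) + log 2 K"
proof -
  have "W \<noteq> {}" using p1 by auto
  then have "0 < (\<Sum>w\<in>W. (1/2::real) ^ l w)"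
    using \<open>finite W\<close> by (intro sum_pos) auto
  then have K0: "K > 0" using K by linarith
  \<comment> \<open>Termwise form: \<open>ln t \<le> t - 1\<close> for the ratio \<open>t\<close> of
    the weight to \<open>p w\<close>, multiplied by \<open>p w\<close>. If \<open>p w = 0\<close>,
    the left side vanishes and the right side is nonnegative.\<close>
  have le: "- (p w * log 2 (p w)) - p w * l w - p w * log 2 K \<le> ((1/2) ^ l w / K - p w) / ln 2"
    if "w \<in> W" for w
  proof (cases "p w = 0")
    case False
    with p[OF that] have p0: "p w > 0" by simp
    define t where "t = (1/2) ^ l w / (K * p w)"
    have "t > 0" using p0 K0 by (simp add: t_def)
    have lnt: "ln t = - (l w * ln 2) - ln K - ln (p w)"
      using p0 K0 by (simp add: t_def ln_div ln_mult ln_realpow power_divide)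
    have "p w * ln t / ln 2 = - (p w * log 2 (p w)) - p w * l w - p w * log 2 K"
      unfolding lnt by (simp add: log_def field_simps)
    moreover have "p w * ln t \<le> p w * (t - 1)"
      using ln_le_minus_one[OF \<open>t > 0\<close>] p0 by (intro mult_left_mono) auto
    moreover have "p w * (t - 1) = (1/2) ^ l w / K - p w"
      using p0 K0 by (simp add: t_def field_simps)
    ultimately show ?thesis
      by (metis divide_right_mono ln_ge_zero one_le_numeral)
  qed (use K0 in simp)
  have "- (\<Sum>w\<in>W. p w * log 2 (p w)) - (\<Sum>w\<in>W. p w * l w) - log 2 K
      = (\<Sum>w\<in>W. - (p w * log 2 (p w)) - p w * l w - p w * log 2 K)"
    using p1 by (simp add: sum_subtractf sum_negf flip: sum_distrib_right)
  also have "\<dots> \<le> (\<Sum>w\<in>W. ((1/2) ^ l w / K - p w) / ln 2)"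
    using le by (rule sum_mono)
  also have "\<dots> = ((\<Sum>w\<in>W. (1/2) ^ l w) / K - 1) / ln 2"
    using p1 by (simp add: sum_subtractf flip: sum_divide_distrib)
  also have "\<dots> \<le> 0"
    using K K0 by (simp add: divide_le_0_iff)
  finally show ?thesis by simp
qed

text \<open>Without prefix-freeness the Kraft sum is not bounded by \<open>1\<close>, but each codeword length
  contributes at most \<open>1\<close> to it.\<close>

lemma kraft_sum_le:
  fixes Z :: "'w \<Rightarrow> bool list"
  assumes "inj_on Z W" and len: "\<And>w. w \<in> W \<Longrightarrow> length (Z w) \<le> N"
  shows "(\<Sum>w\<in>W. (1/2::real) ^ length (Z w)) \<le> real N + 1"
proof -
  have fin: "finite {v::bool list. length v = i}" for i
    using finite_lists_length_eq[of "UNIV::bool set" i] by simp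
  have card: "card {v::bool list. length v = i} = 2 ^ i" for i
    using card_lists_length_eq[of "UNIV::bool set" i] by simp
  have "(\<Sum>w\<in>W. (1/2::real) ^ length (Z w)) = (\<Sum>v\<in>Z ` W. (1/2) ^ length v)"
    using assms(1) by (simp add: sum.reindex)
  also have "\<dots> \<le> (\<Sum>v\<in>(\<Union>i\<in>{..N}. {v::bool list. length v = i}). (1/2) ^ length v)"
    by (intro sum_mono2) (use len fin in auto)
  also have "\<dots> = (\<Sum>i\<in>{..N}. \<Sum>v | length v = i. (1/2) ^ length (v::bool list))"
    using fin by (intro sum.UNION_disjoint) auto
  also have "\<dots> = (\<Sum>i\<in>{..N}. 1)"
    by (intro sum.cong refl) (simp add: card power_divide)
  finally show ?thesis by simp
qed

section \<open>Limits superior and reverse Fatou\<close>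

text \<open>Parametricity of \<open>limsup\<close> along the embedding. It connects the rate, an
  \<open>ereal\<close>, with the nonnegative integral, which lives in
  \<open>ennreal\<close>.\<close>

lemma limsup_enn2ereal:
  "limsup (\<lambda>n. enn2ereal (f n)) = enn2ereal (limsup f)"
proof -
  have "rel_fun (=) pcr_ennreal (\<lambda>n. enn2ereal (f n)) f"
    by (simp add: rel_fun_def ennreal.pcr_cr_eq cr_ennreal_def)
  then have "pcr_ennreal (limsup (\<lambda>n. enn2ereal (f n))) (limsup f)"
    by (rule rel_fun_limsup[THEN rel_funD])
  then show ?thesis
    by (simp add: ennreal.pcr_cr_eq cr_ennreal_def)
qed

text \<open>If the averages of \<open>L n\<close> dominate \<open>a n\<close> asymptotically while \<open>limsup L\<close> is below every \<open>a k\<close>,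
  reverse Fatou closes the loop: it forces both convergence of \<open>a\<close> and equality.\<close>

lemma (in prob_space) limsup_eq_lim:
  fixes L :: "nat \<Rightarrow> 'a \<Rightarrow> real"
  assumes meas [measurable]: "\<And>n. L n \<in> borel_measurable M"
    and L: "\<And>n x. 0 \<le> L n x" "\<And>n x. x \<in> space M \<Longrightarrow> L n x \<le> C"
    and upper: "\<And>k. k \<ge> 1 \<Longrightarrow> AE x in M. limsup (\<lambda>n. ereal (L n x)) \<le> ereal (a k)"
    and lower: "\<And>n. n \<ge> 1 \<Longrightarrow> a n \<le> (\<integral>x. L n x \<partial>M) + e n" and e: "e \<longlonglongrightarrow> 0"
  shows "AE x in M. limsup (\<lambda>n. ereal (L n x)) = ereal (lim a)"
proof -
  define K where "K x = limsup (\<lambda>n. ennreal (L n x))" for x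
  have [measurable]: "K \<in> borel_measurable M"
    unfolding K_def by measurable
  have K: "limsup (\<lambda>n. ereal (L n x)) = enn2ereal (K x)" for x
    using limsup_enn2ereal[of "\<lambda>n. ennreal (L n x)"] L(1) by (simp add: K_def enn2ereal_ennreal)
  \<comment> \<open>A property that holds almost everywhere on a probability space holds at some
    point; there a limsup of nonnegative terms lies below \<open>a k\<close>, so \<open>a k\<close>
    is nonnegative.\<close>
  have "\<exists>x\<in>space M. limsup (\<lambda>n. ereal (L n x)) \<le> ereal (a k)" if "k \<ge> 1" for k
  proof (rule ccontr)
    assume "\<not> ?thesis"
    then have "AE x in M. False"
      using upper[OF that] by (auto elim!: AE_mp)
    then show False by simp
  qed
  then have a0: "0 \<le> a k" if "k \<ge> 1" for k
    using that unfolding K by (metis enn2ereal_nonneg ereal_less_eq(5) order_trans)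
  \<comment> \<open>Index 0 stays out: \<open>upper\<close> says nothing about it, and for entropies
    per symbol \<open>a 0\<close> is a division by zero, whose value 0 would spoil the
    infimum.\<close>
  define h where "h = (INF k\<in>{1..}. a k)"
  have bdd: "bdd_below (a ` {1..})"
    using a0 by (auto intro!: bdd_belowI[of _ 0])
  have h0: "0 \<le> h"
    unfolding h_def using a0 by (intro cINF_greatest) auto
  have h_le: "h \<le> a k" if "k \<ge> 1" for k
    unfolding h_def using that bdd by (intro cINF_lower) auto
  have "AE x in M. \<forall>k\<in>{1..}. limsup (\<lambda>n. ereal (L n x)) \<le> ereal (a k)"
    using upper by (intro AE_ball_countable') auto
  then have K_le: "AE x in M. K x \<le> ennreal h"
  proof eventually_elim
    case (elim x)
    have "K x \<noteq> top"
      using elim unfolding K by (auto dest!: bspec[of _ _ 1])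
    then obtain c where c: "K x = ennreal c" "c \<ge> 0"
      by (cases "K x") auto
    have "c \<le> a k" if "k \<ge> 1" for k
      using elim that c unfolding K by (auto simp: enn2ereal_ennreal)
    then have "c \<le> h"
      unfolding h_def by (intro cINF_greatest) auto
    then show ?case
      using c by (simp add: ennreal_leI)
  qed
  have int: "integrable M (L n)" for n
    using L by (intro integrable_const_bound[of _ C]) auto
  have nn: "(\<integral>\<^sup>+ x. ennreal (L n x) \<partial>M) = ennreal (\<integral>x. L n x \<partial>M)" for n
    using L int by (intro nn_integral_eq_integral) auto
  have mean_nonneg: "0 \<le> (\<integral>x. L n x \<partial>M)" for n
    using L by (intro integral_nonneg_AE) auto
  have fatou: "limsup (\<lambda>n. ennreal (\<integral>x. L n x \<partial>M)) \<le> (\<integral>\<^sup>+ x. K x \<partial>M)"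
    unfolding K_def nn[symmetric]
    by (rule nn_integral_limsup[where w = "\<lambda>_. ennreal C"]) (use L in \<open>auto intro!: ennreal_leI simp: emeasure_space_1\<close>)
  have K_int_le: "(\<integral>\<^sup>+ x. K x \<partial>M) \<le> ennreal h"
    using nn_integral_mono_AE[OF K_le] by (simp add: emeasure_space_1)
  \<comment> \<open>From below \<open>a\<close> is bounded by its infimum \<open>h\<close>. From
    above, \<open>a n\<close> is at most the mean of \<open>L n\<close> plus \<open>e n\<close>, and
    the limsup of the means is at most \<open>h\<close>.\<close>
  have "a \<longlonglongrightarrow> h"
  proof (rule tendstoI)
    fix d :: real assume d: "d > 0"
    have "limsup (\<lambda>n. ennreal (\<integral>x. L n x \<partial>M)) < ennreal (h + d / 2)"
      using order_trans[OF fatou K_int_le] d h0 by (elim order.strict_trans1) (simp add: ennreal_less_iff)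
    then have "\<forall>\<^sub>F n in sequentially. ennreal (\<integral>x. L n x \<partial>M) < ennreal (h + d / 2)"
      by (rule Limsup_lessD)
    moreover have "\<forall>\<^sub>F n in sequentially. e n < d / 2"
      using e d by (intro order_tendstoD) auto
    ultimately show "\<forall>\<^sub>F n in sequentially. dist (a n) h < d"
      using eventually_ge_at_top[of 1]
    proof eventually_elim
      case (elim n)
      then have "(\<integral>x. L n x \<partial>M) < h + d / 2"
        using mean_nonneg by (simp add: ennreal_less_iff)
      then show ?case
        using elim lower[of n] h_le[of n] by (simp add: dist_real_def)
    qed
  qed
  then have lim: "lim a = h" by (rule limI)
  \<comment> \<open>The means dominate \<open>a n - e n\<close>, so with \<open>fatou\<close> the
    integral of \<open>K\<close> is at least \<open>h\<close>. Together with \<open>K_int_le\<close>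
    it equals \<open>h\<close>.\<close>
  have "(\<lambda>n. a n - e n) \<longlonglongrightarrow> h"
    using tendsto_diff[OF \<open>a \<longlonglongrightarrow> h\<close> e] by simp
  then have "(\<lambda>n. ennreal (a n - e n)) \<longlonglongrightarrow> ennreal h"
    by (rule tendsto_ennrealI)
  then have "ennreal h = limsup (\<lambda>n. ennreal (a n - e n))"
    by (intro lim_imp_Limsup[symmetric]) auto
  also have "\<dots> \<le> limsup (\<lambda>n. ennreal (\<integral>x. L n x \<partial>M))"
    by (intro Limsup_mono eventually_mono[OF eventually_ge_at_top[of 1]] ennreal_leI)
       (use lower in \<open>simp add: algebra_simps\<close>)
  also note fatou
  finally have "(\<integral>\<^sup>+ x. K x \<partial>M) = ennreal h"
    using K_int_le by simp
  moreover from this have "(\<integral>\<^sup>+ x. (ennreal h - K x) \<partial>M) = (\<integral>\<^sup>+ x. ennreal h \<partial>M) - (\<integral>\<^sup>+ x. K x \<partial>M)"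
    using K_le by (intro nn_integral_diff) auto
  ultimately have "(\<integral>\<^sup>+ x. (ennreal h - K x) \<partial>M) = 0"
    by (simp add: emeasure_space_1)
  \<comment> \<open>Subtraction in \<open>ennreal\<close> is truncated, so this alone gives only
    \<open>h \<le> K x\<close>; equality also uses \<open>K_le\<close>.\<close>
  then have "AE x in M. ennreal h - K x = 0"
    by (subst (asm) nn_integral_0_iff_AE) auto
  with K_le have "AE x in M. K x = ennreal h"
    by eventually_elim (auto intro!: antisym dest: ennreal_minus_eq_0)
  then show ?thesis
    by eventually_elim (use h0 in \<open>simp add: K lim enn2ereal_ennreal\<close>)
qed

section \<open>Birkhoff's ergodic theorem\<close>

locale ergodic_system = prob_space M for M :: "'a measure" +
  fixes T :: "'a \<Rightarrow> 'a"
  assumes T_measurable [measurable]: "T \<in> M \<rightarrow>\<^sub>M M"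
    and T_invariant: "distr M M T = M"
    and T_ergodic: "ergodic M T"
begin

lemma T_space: "x \<in> space M \<Longrightarrow> T x \<in> space M"
  using T_measurable by (rule measurable_space)

lemma T_iterate_measurable [measurable]: "(T ^^ n) \<in> M \<rightarrow>\<^sub>M M"
  by (induction n) (auto simp: id_def)

lemma integrable_T:
  fixes f :: "'a \<Rightarrow> real"
  assumes "integrable M f"
  shows "integrable M (\<lambda>x. f (T x))"
  using integrable_distr[OF T_measurable] assms by (simp add: T_invariant)

lemma integral_T:
  fixes f :: "'a \<Rightarrow> real"
  assumes "f \<in> borel_measurable M"
  shows "(\<integral>x. f (T x) \<partial>M) = (\<integral>x. f x \<partial>M)"
  using integral_distr[OF T_measurable assms] by (simp add: T_invariant)

text \<open>\<open>max_sum f n x\<close> is the largest of the Birkhoff sums of lengths \<open>1, \<dots>, n + 1\<close>.\<close>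

primrec max_sum :: "('a \<Rightarrow> real) \<Rightarrow> nat \<Rightarrow> 'a \<Rightarrow> real" where
  "max_sum f 0 x = f x"
| "max_sum f (Suc n) x = f x + max 0 (max_sum f n (T x))"

lemma birkhoff_sum_Suc:
  fixes f :: "'a \<Rightarrow> real"
  shows "(\<Sum>i<Suc n. f ((T ^^ i) x)) = f x + (\<Sum>i<n. f ((T ^^ i) (T x)))"
  by (subst sum.lessThan_Suc_shift) (simp add: funpow_swap1)

lemma birkhoff_sum_le_max_sum: "(\<Sum>i<Suc n. f ((T ^^ i) x)) \<le> max_sum f n x"
proof (induction n arbitrary: x)
  case (Suc n)
  show ?case using Suc[of "T x"] by (subst birkhoff_sum_Suc) simp
qed simp

lemma max_sum_le_Suc: "max_sum f n x \<le> max_sum f (Suc n) x"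
proof (induction n arbitrary: x)
  case (Suc n)
  show ?case using Suc[of "T x"] by auto
qed simp

lemma max_sum_mono: "m \<le> n \<Longrightarrow> max_sum f m x \<le> max_sum f n x"
  using max_sum_le_Suc by (rule lift_Suc_mono_le)

lemma integrable_max_sum:
  assumes "integrable M f"
  shows "integrable M (max_sum f n)"
proof (induction n)
  case (Suc n)
  have "integrable M (\<lambda>x. f x + max 0 (max_sum f n (T x)))"
    using assms integrable_T[OF Suc] by (intro Bochner_Integration.integrable_add integrable_max) auto
  then show ?case by (simp add: fun_eq_iff[of "max_sum f (Suc n)"] cong: Bochner_Integration.integrable_cong)
qed (use assms in \<open>simp cong: Bochner_Integration.integrable_cong\<close>)

text \<open>By the recursion the two sequences differ by a shift, the finite term \<open>f x\<close>
  and a cut at 0. Hence the set of points with unbounded sums is strictly invariant, as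
  \<open>ergodic\<close> demands.\<close>

lemma max_sum_bounded_iff:
  "(\<exists>B. \<forall>n. max_sum f n (T x) \<le> B) \<longleftrightarrow> (\<exists>B. \<forall>n. max_sum f n x \<le> B)"
proof
  assume "\<exists>B. \<forall>n. max_sum f n (T x) \<le> B"
  then obtain B where B: "\<And>n. max_sum f n (T x) \<le> B" by blast
  have "max_sum f n x \<le> f x + max 0 B" for n
    by (cases n) (use B in \<open>auto intro!: max.coboundedI2\<close>)
  then show "\<exists>B. \<forall>n. max_sum f n x \<le> B" by blast
next
  assume "\<exists>B. \<forall>n. max_sum f n x \<le> B"
  then obtain B where B: "\<And>n. max_sum f n x \<le> B" by blast
  have "max_sum f n (T x) \<le> B - f x" for n
    using B[of "Suc n"] by simp
  then show "\<exists>B. \<forall>n. max_sum f n (T x) \<le> B" by blast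
qed

text \<open>The points with unbounded sums form an invariant set, null or of full measure by
  ergodicity. In the second case the functions
  \<open>max_sum f (Suc n) x - max_sum f n (T x)\<close> have nonnegative integrals and converge to
  \<open>f\<close>, against the negative mean.\<close>

lemma AE_birkhoff_sum_bounded:
  fixes f :: "'a \<Rightarrow> real"
  assumes f: "integrable M f" and neg: "(\<integral>x. f x \<partial>M) < 0"
  shows "AE x in M. \<exists>B. \<forall>n. (\<Sum>i<n. f ((T ^^ i) x)) \<le> B"
proof -
  note int = integrable_max_sum[OF f]
  note meas [measurable] = borel_measurable_integrable[OF f] borel_measurable_integrable[OF int]
  \<comment> \<open>The bound ranges over \<open>nat\<close> so that \<open>E\<close> is built from
    countably many measurable sets.\<close>
  define E where "E = {x \<in> space M. \<not> (\<exists>B::nat. \<forall>n. max_sum f n x \<le> B)}"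
  have E_iff: "x \<in> E \<longleftrightarrow> x \<in> space M \<and> \<not> (\<exists>B. \<forall>n. max_sum f n x \<le> B)" for x
  proof -
    have "(\<exists>B::nat. \<forall>n. max_sum f n x \<le> B) \<longleftrightarrow> (\<exists>B. \<forall>n. max_sum f n x \<le> B)"
      by (meson order_trans real_arch_simple)
    then show ?thesis unfolding E_def by blast
  qed
  have [measurable]: "E \<in> sets M" unfolding E_def by measurable
  have "T -` E \<inter> space M = E"
    by (auto simp: E_iff max_sum_bounded_iff T_space)
  then consider "measure M E = 0" | "measure M E = 1"
    using T_ergodic \<open>E \<in> sets M\<close> unfolding ergodic_def by blast
  then have "AE x in M. x \<notin> E"
  proof cases
    case 1
    then show ?thesis
      using prob_eq_0 \<open>E \<in> sets M\<close> by blast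
  next
    case 2
    then have AE_E: "AE x in M. x \<in> E"
      by (rule AE_prob_1)
    define g where "g n x = f x - min 0 (max_sum f n (T x))" for n x
    have g_eq: "g n x = max_sum f (Suc n) x - max_sum f n (T x)" for n x
      by (simp add: g_def min_def max_def)
    have g_nonneg: "0 \<le> (\<integral>x. g n x \<partial>M)" for n
    proof -
      have "(\<integral>x. g n x \<partial>M) = (\<integral>x. max_sum f (Suc n) x \<partial>M) - (\<integral>x. max_sum f n (T x) \<partial>M)"
        unfolding g_eq by (rule Bochner_Integration.integral_diff[OF int integrable_T[OF int]])
      \<comment> \<open>Invariance of the measure removes \<open>T\<close>; monotonicity in
        \<open>n\<close> then gives the sign.\<close>
      also have "\<dots> = (\<integral>x. max_sum f (Suc n) x \<partial>M) - (\<integral>x. max_sum f n x \<partial>M)"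
        by (subst integral_T) auto
      also have "\<dots> \<ge> 0"
        using integral_mono[OF int int max_sum_le_Suc] by simp
      finally show ?thesis .
    qed
    have "(\<lambda>n. \<integral>x. g n x \<partial>M) \<longlonglongrightarrow> (\<integral>x. f x \<partial>M)"
    proof (rule integral_dominated_convergence)
      show "integrable M (\<lambda>x. \<bar>f x\<bar> + \<bar>f (T x)\<bar>)"
        using f integrable_T[OF f] by simp
      show "g n \<in> borel_measurable M" for n
        unfolding g_def by measurable
      \<comment> \<open>Since \<open>max_sum f n (T x)\<close> is at least \<open>f (T x)\<close>,
        its negative part is at most \<open>\<bar>f (T x)\<bar>\<close>.\<close>
      show "AE x in M. norm (g n x) \<le> \<bar>f x\<bar> + \<bar>f (T x)\<bar>" for n
        using max_sum_mono[of 0 n f] by (intro AE_I2) (simp add: g_def min_def abs_if, smt (verit))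
      show "AE x in M. (\<lambda>n. g n x) \<longlonglongrightarrow> f x"
        using AE_E
      proof eventually_elim
        case (elim x)
        \<comment> \<open>The sums are unbounded at \<open>T x\<close> too, so they become positive
          there; from then on the minimum in \<open>g\<close> is 0.\<close>
        then obtain N where "max_sum f N (T x) > 0"
          using max_sum_bounded_iff[of f x] E_iff[of x] by (meson not_le)
        then have "\<forall>n\<ge>N. g n x = f x"
          by (smt (verit) g_def max_sum_mono)
        then show ?case
          by (intro tendsto_eventually) (auto simp: eventually_sequentially)
      qed
    qed simp
    then have "0 \<le> (\<integral>x. f x \<partial>M)"
      by (rule LIMSEQ_le_const) (use g_nonneg in blast)
    with neg show ?thesis by simp
  qed
  with AE_space show ?thesis
  proof eventually_elim
    case (elim x)
    then obtain B where B: "\<And>n. max_sum f n x \<le> B"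
      by (auto simp: E_iff)
    have "(\<Sum>i<n. f ((T ^^ i) x)) \<le> max 0 B" for n
    proof (cases n)
      case (Suc m)
      then show ?thesis
        using birkhoff_sum_le_max_sum[of f x m] B[of m] by simp
    qed simp
    then show ?case by blast
  qed
qed

lemma AE_birkhoff_average_less:
  fixes f :: "'a \<Rightarrow> real"
  assumes f: "integrable M f" and e: "e > 0"
  shows "AE x in M. \<forall>\<^sub>F n in sequentially. (\<Sum>i<n. f ((T ^^ i) x)) / n < (\<integral>x. f x \<partial>M) + e"
proof -
  \<comment> \<open>Half of \<open>e\<close> makes the mean of \<open>f - c\<close> negative; the
    other half absorbs \<open>B / n\<close>.\<close>
  define c where "c = (\<integral>x. f x \<partial>M) + e / 2"
  have "AE x in M. \<exists>B. \<forall>n. (\<Sum>i<n. f ((T ^^ i) x) - c) \<le> B"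
    by (rule AE_birkhoff_sum_bounded) (use f e in \<open>auto simp: c_def prob_space\<close>)
  then show ?thesis
  proof eventually_elim
    case (elim x)
    then obtain B where B: "\<And>n. (\<Sum>i<n. f ((T ^^ i) x)) \<le> B + n * c"
      by (auto simp: sum_subtractf algebra_simps)
    have "(\<lambda>n. B / real n) \<longlonglongrightarrow> 0"
      by (rule lim_const_over_n)
    then have "\<forall>\<^sub>F n in sequentially. B / real n < e / 2"
      using e by (intro order_tendstoD) auto
    then show ?case
      using eventually_gt_at_top[of 0]
    proof eventually_elim
      case (elim n)
      have "(\<Sum>i<n. f ((T ^^ i) x)) / n \<le> (B + n * c) / n"
        using B elim by (intro divide_right_mono) auto
      also have "\<dots> = B / n + c"
        using elim by (simp add: field_simps)
      finally show ?case
        using elim unfolding c_def by linarith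
    qed
  qed
qed

text \<open>The one-sided estimate is used for \<open>f\<close> and for \<open>- f\<close>. Running
  the error through \<open>inverse (Suc m)\<close> leaves countably many null sets.\<close>

theorem birkhoff_ergodic:
  fixes f :: "'a \<Rightarrow> real"
  assumes f: "integrable M f"
  shows "AE x in M. (\<lambda>n. (\<Sum>i<n. f ((T ^^ i) x)) / n) \<longlonglongrightarrow> (\<integral>x. f x \<partial>M)"
proof -
  have "AE x in M. \<forall>m. (\<forall>\<^sub>F n in sequentially. (\<Sum>i<n. f ((T ^^ i) x)) / n < (\<integral>x. f x \<partial>M) + inverse (Suc m))
     \<and> (\<forall>\<^sub>F n in sequentially. (\<Sum>i<n. - f ((T ^^ i) x)) / n < (\<integral>x. - f x \<partial>M) + inverse (Suc m))"
    using f by (subst AE_all_countable, intro allI AE_conjI AE_birkhoff_average_less) auto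
  then show ?thesis
  proof eventually_elim
    case (elim x)
    show ?case
    proof (rule tendstoI)
      fix e :: real assume "e > 0"
      then obtain m where m: "inverse (Suc m) < e"
        using reals_Archimedean by blast
      from elim have "\<forall>\<^sub>F n in sequentially. (\<Sum>i<n. f ((T ^^ i) x)) / n < (\<integral>x. f x \<partial>M) + inverse (Suc m)"
        and "\<forall>\<^sub>F n in sequentially. (\<Sum>i<n. - f ((T ^^ i) x)) / n < (\<integral>x. - f x \<partial>M) + inverse (Suc m)"
        by blast+
      then show "\<forall>\<^sub>F n in sequentially. dist ((\<Sum>i<n. f ((T ^^ i) x)) / n) (\<integral>x. f x \<partial>M) < e"
        by eventually_elim (use m in \<open>auto simp: dist_real_def sum_negf abs_less_iff\<close>)
    qed
  qed
qed

end

section \<open>Words, cylinders and empirical entropy\<close>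

lemma finite_words [simp]: "finite (words r n)"
  using finite_lists_length_eq[of "{1..r}" n] by (simp add: words_def lists_eq_set)

text \<open>If \<open>w\<close> is longer than \<open>s\<close>, the denominator can be zero or
  negative, but the guard inside the set makes the count 0.\<close>

lemma emp_freq_nonneg: "0 \<le> emp_freq s w"
proof (cases "length w \<le> length s")
  case True
  then show ?thesis by (simp add: emp_freq_def)
qed (simp add: emp_freq_def)

locale coded_system = ergodic_system +
  fixes A :: "nat \<Rightarrow> 'a set" and r :: nat
  assumes A_sets [measurable]: "\<And>i. i \<in> {1..r} \<Longrightarrow> A i \<in> sets M"
    and A_disjoint: "\<And>i j. i \<in> {1..r} \<Longrightarrow> j \<in> {1..r} \<Longrightarrow> i \<noteq> j \<Longrightarrow> A i \<inter> A j = {}"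
    and A_cover: "(\<Union>i\<in>{1..r}. A i) = space M"
begin

abbreviation cyl :: "nat list \<Rightarrow> 'a set" where
  "cyl \<equiv> cylinder (space M) T A"

definition block :: "nat \<Rightarrow> 'a \<Rightarrow> nat list" where
  "block n x = map (sym_coding T A r x) [0..<n]"

lemma length_block [simp]: "length (block n x) = n"
  by (simp add: block_def)

lemma T_iterate_space: "x \<in> space M \<Longrightarrow> (T ^^ n) x \<in> space M"
  using T_iterate_measurable by (rule measurable_space)

lemma sym_coding_in:
  assumes "x \<in> space M"
  shows "sym_coding T A r x j \<in> {1..r} \<and> (T ^^ j) x \<in> A (sym_coding T A r x j)"
proof -
  obtain i where i: "i \<in> {1..r}" "(T ^^ j) x \<in> A i"
    using T_iterate_space[OF assms, of j] A_cover by blast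
  show ?thesis
    unfolding sym_coding_def
    by (rule theI[of _ i]) (use i A_disjoint in blast)+
qed

lemma sym_coding_eq_iff:
  assumes "x \<in> space M" "i \<in> {1..r}"
  shows "sym_coding T A r x j = i \<longleftrightarrow> (T ^^ j) x \<in> A i"
  using sym_coding_in[OF assms(1), of j] A_disjoint assms(2) by blast

lemma block_in_words: "x \<in> space M \<Longrightarrow> block n x \<in> words r n"
  using sym_coding_in[of x] by (auto simp: words_def block_def)

lemma words_nth: "w \<in> words r n \<Longrightarrow> j < n \<Longrightarrow> w ! j \<in> {1..r}"
  by (auto simp: words_def in_lists_conv_set)

lemma words_length: "w \<in> words r n \<Longrightarrow> length w = n"
  by (simp add: words_def)

text \<open>Occurrences of \<open>w\<close> in the coded orbit are visits of the orbit to the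
  cylinder of \<open>w\<close>; this turns empirical frequencies into Birkhoff averages.\<close>

lemma factor_eq_iff:
  assumes x: "x \<in> space M" and w: "w \<in> words r k" and "i + k \<le> n"
  shows "take k (drop i (block n x)) = w \<longleftrightarrow> (T ^^ i) x \<in> cyl w"
proof -
  have "take k (drop i (block n x)) = w \<longleftrightarrow> (\<forall>j<k. sym_coding T A r x (i + j) = w ! j)"
    using assms words_length[OF w] by (auto simp: list_eq_iff_nth_eq block_def)
  also have "\<dots> \<longleftrightarrow> (\<forall>j<k. (T ^^ j) ((T ^^ i) x) \<in> A (w ! j))"
    using x words_nth[OF w] by (auto simp: sym_coding_eq_iff funpow_add add.commute[of i])
  finally show ?thesis
    using x words_length[OF w] by (simp add: cylinder_def T_iterate_space)
qed

lemma block_eq_iff: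
  assumes "x \<in> space M" "w \<in> words r n"
  shows "block n x = w \<longleftrightarrow> x \<in> cyl w"
  using factor_eq_iff[OF assms, of 0 n] by simp

lemma cylinder_sets [measurable]:
  assumes "w \<in> words r n"
  shows "cyl w \<in> sets M"
proof -
  have [measurable]: "A (w ! j) \<in> sets M" if "j < length w" for j
    using assms that words_length words_nth A_sets by metis
  have "cyl w = {x \<in> space M. \<forall>j\<in>{..<length w}. (T ^^ j) x \<in> A (w ! j)}"
    by (auto simp: cylinder_def)
  also have "\<dots> \<in> sets M"
    by (rule sets.sets_Collect_finite_All) auto
  finally show ?thesis .
qed

text \<open>The cylinders of length \<open>n\<close> partition the space, so a single term survives.
  Every function of the block is thereby a simple function, measurable and easy to
  integrate.\<close>

lemma of_block_eq_sum:
  fixes g :: "nat list \<Rightarrow> real"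
  assumes "x \<in> space M"
  shows "g (block n x) = (\<Sum>w\<in>words r n. indicator (cyl w) x * g w)"
proof -
  have "(\<Sum>w\<in>words r n. indicator (cyl w) x * g w) = (\<Sum>w\<in>words r n. if w = block n x then g w else 0)"
    using assms by (intro sum.cong) (auto simp: block_eq_iff[symmetric] indicator_def)
  then show ?thesis
    using block_in_words[OF assms, of n] by (simp add: sum.delta)
qed

lemma borel_measurable_of_block [measurable]:
  fixes g :: "nat list \<Rightarrow> real"
  shows "(\<lambda>x. g (block n x)) \<in> borel_measurable M"
  by (subst measurable_cong[OF of_block_eq_sum]) measurable

lemma integral_of_block:
  fixes g :: "nat list \<Rightarrow> real"
  shows "(\<integral>x. g (block n x) \<partial>M) = (\<Sum>w\<in>words r n. measure M (cyl w) * g w)"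
proof -
  have "(\<integral>x. g (block n x) \<partial>M) = (\<integral>x. (\<Sum>w\<in>words r n. indicator (cyl w) x * g w) \<partial>M)"
    by (intro Bochner_Integration.integral_cong of_block_eq_sum refl)
  also have "\<dots> = (\<Sum>w\<in>words r n. \<integral>x. indicator (cyl w) x * g w \<partial>M)"
    by (intro Bochner_Integration.integral_sum)
       (auto intro!: integrable_mult_left integrable_real_indicator simp: emeasure_eq_measure)
  also have "\<dots> = (\<Sum>w\<in>words r n. measure M (cyl w) * g w)"
    using sets.sets_into_space[OF cylinder_sets] by (intro sum.cong refl) (auto simp: Int_absorb2)
  finally show ?thesis .
qed

lemma sum_measure_cylinder: "(\<Sum>w\<in>words r n. measure M (cyl w)) = 1"
  using integral_of_block[of "\<lambda>_. 1" n] by (simp add: prob_space)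

lemma emp_freq_block:
  assumes x: "x \<in> space M" and w: "w \<in> words r k" and "k \<le> n"
  shows "emp_freq (block n x) w
    = (\<Sum>i<n - k + 1. indicator (cyl w) ((T ^^ i) x)) / real (n - k + 1)"
proof -
  have "{i. i \<le> length (block n x) - length w \<and> length w \<le> length (block n x) \<and>
          take (length w) (drop i (block n x)) = w}
      = {i\<in>{..<n - k + 1}. (T ^^ i) x \<in> cyl w}"
  proof -
    have "take k (drop i (block n x)) = w \<longleftrightarrow> (T ^^ i) x \<in> cyl w" if "i \<le> n - k" for i
      using that assms(3) by (intro factor_eq_iff[OF x w]) simp
    then show ?thesis
      using assms(3) words_length[OF w] by auto
  qed
  moreover have "(\<Sum>i<n - k + 1. indicator (cyl w) ((T ^^ i) x))
      = real (card {i\<in>{..<n - k + 1}. (T ^^ i) x \<in> cyl w})"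
    unfolding indicator_def by (subst sum_of_bool_eq) (auto simp: Int_def)
  ultimately show ?thesis
    using assms(3) words_length[OF w] by (simp add: emp_freq_def of_nat_diff)
qed

lemma AE_emp_freq_tendsto:
  assumes w: "w \<in> words r k"
  shows "AE x in M. (\<lambda>n. emp_freq (block n x) w) \<longlonglongrightarrow> measure M (cyl w)"
proof -
  have "integrable M (indicator (cyl w) :: 'a \<Rightarrow> real)"
    using cylinder_sets[OF w] by (simp add: integrable_real_indicator emeasure_eq_measure)
  from birkhoff_ergodic[OF this] AE_space show ?thesis
  proof eventually_elim
    case (elim x)
    have "(\<integral>x. indicator (cyl w) x \<partial>M) = measure M (cyl w)"
      using sets.sets_into_space[OF cylinder_sets[OF w]] by (simp add: Int_absorb2)
    with elim have "(\<lambda>n. (\<Sum>i<n. indicator (cyl w) ((T ^^ i) x)) / real n) \<longlonglongrightarrow> measure M (cyl w)"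
      by simp
    \<comment> \<open>A string of length \<open>n\<close> has \<open>n - k + 1\<close> windows of
      length \<open>k\<close>, so the Birkhoff limit is taken along this shifted index.\<close>
    moreover have "filterlim (\<lambda>n. n - k + 1) sequentially sequentially"
      by (rule filterlim_compose[OF filterlim_add_const_nat_at_top filterlim_minus_const_nat_at_top])
    ultimately have "(\<lambda>n. (\<Sum>i<n - k + 1. indicator (cyl w) ((T ^^ i) x)) / real (n - k + 1))
        \<longlonglongrightarrow> measure M (cyl w)"
      by (rule filterlim_compose)
    then show ?case
      by (rule Lim_transform_eventually)
         (use eventually_ge_at_top[of k] in \<open>eventually_elim, use elim w in \<open>simp add: emp_freq_block\<close>\<close>)
  qed
qed

text \<open>There are finitely many words of length \<open>k\<close>, so their frequencies converge
  off one common null set; continuity of \<open>x * log 2 x\<close> on \<open>{0..}\<close> covers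
  cylinders of measure 0.\<close>

lemma AE_emp_entropy_tendsto:
  "AE x in M. (\<lambda>n. emp_entropy r k (block n x)) \<longlonglongrightarrow> part_entropy_n M T A r k / real k"
proof -
  have "AE x in M. \<forall>w\<in>words r k. (\<lambda>n. emp_freq (block n x) w) \<longlonglongrightarrow> measure M (cyl w)"
    using AE_emp_freq_tendsto by (intro AE_finite_allI) auto
  then show ?thesis
  proof eventually_elim
    case (elim x)
    have "(\<lambda>n. - (1 / real k) * (\<Sum>w\<in>words r k. emp_freq (block n x) w * log 2 (emp_freq (block n x) w)))
        \<longlonglongrightarrow> - (1 / real k) * (\<Sum>w\<in>words r k. measure M (cyl w) * log 2 (measure M (cyl w)))"
      using elim by (intro tendsto_intros tendsto_mult_log2 emp_freq_nonneg) auto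
    then show ?case
      by (simp add: emp_entropy_def part_entropy_n_def)
  qed
qed

end

section \<open>Uniform bounds from optimality\<close>

lemma emp_entropy_le:
  assumes "k \<ge> 1"
  shows "emp_entropy r k s \<le> real (card (words r k)) / ln 2"
proof -
  have "(\<Sum>w\<in>words r k. - (1 / ln 2)) \<le> (\<Sum>w\<in>words r k. emp_freq s w * log 2 (emp_freq s w))"
    by (intro sum_mono mult_log2_ge emp_freq_nonneg)
  then have "- (\<Sum>w\<in>words r k. emp_freq s w * log 2 (emp_freq s w)) \<le> real (card (words r k)) / ln 2"
    by simp
  then have "- (\<Sum>w\<in>words r k. emp_freq s w * log 2 (emp_freq s w)) / real k
      \<le> real (card (words r k)) / ln 2 / real k"
    by (rule divide_right_mono) simp
  also have "\<dots> \<le> real (card (words r k)) / ln 2 / 1"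
    using assms by (intro divide_left_mono) auto
  finally show ?thesis by (simp add: emp_entropy_def)
qed

lemma optimal_codingE:
  assumes "optimal_coding r Z" "k \<ge> 1"
  obtains f :: "nat \<Rightarrow> real" where "f \<longlonglongrightarrow> 0"
    "\<And>s. s \<in> lists {1..r} \<Longrightarrow> real (length (Z s)) / real (length s) \<le> emp_entropy r k s + f (length s)"
proof -
  obtain f :: "nat \<Rightarrow> real" where f: "f \<in> o(\<lambda>n. real n)"
      "\<And>s. s \<in> lists {1..r} \<Longrightarrow>
        real (length (Z s)) / real (length s) \<le> emp_entropy r k s + f (length s) / real (length s)"
    using assms unfolding optimal_coding_def by blast
  show ?thesis
    by (rule that[of "\<lambda>n. f n / real n"]) (use f smalloD_tendsto in auto)
qed

text \<open>Optimality at \<open>k = 1\<close> suffices, as the empirical entropy and the convergent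
  error are both bounded. The constant serves as dominating function for reverse Fatou and as length
  bound for the Kraft sum.\<close>

lemma optimal_coding_rate_bounded:
  assumes "optimal_coding r Z"
  obtains C where "C \<ge> 0"
    "\<And>s. s \<in> lists {1..r} \<Longrightarrow> real (length (Z s)) / real (length s) \<le> C"
proof -
  obtain f :: "nat \<Rightarrow> real" where f: "f \<longlonglongrightarrow> 0"
      "\<And>s. s \<in> lists {1..r} \<Longrightarrow> real (length (Z s)) / real (length s) \<le> emp_entropy r 1 s + f (length s)"
    using optimal_codingE[OF assms, of 1] by auto
  obtain B where B: "\<And>n. \<bar>f n\<bar> \<le> B"
    using convergent_imp_Bseq[OF convergentI[OF f(1)]] by (auto simp: Bseq_def)
  show ?thesis
  proof (rule that[of "\<bar>real (card (words r 1)) / ln 2 + B\<bar>"])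
    fix s assume s: "s \<in> lists {1..r}"
    show "real (length (Z s)) / real (length s) \<le> \<bar>real (card (words r 1)) / ln 2 + B\<bar>"
      using f(2)[OF s] emp_entropy_le[of 1 r s] B[of "length s"] by linarith
  qed simp
qed

section \<open>Coding rate and entropy\<close>

context coded_system
begin

lemma block_in_lists: "x \<in> space M \<Longrightarrow> block n x \<in> lists {1..r}"
  using block_in_words by (auto simp: words_def)

theorem AE_rate_eq_entropy:
  assumes Z: "optimal_coding r Z"
  shows "AE x in M. limsup (\<lambda>n. ereal (real (length (Z (block n x))) / real n)) = ereal (KS_entropy M T A r)"
proof -
  obtain C where C: "C \<ge> 0"
    "\<And>s. s \<in> lists {1..r} \<Longrightarrow> real (length (Z s)) / real (length s) \<le> C"
    using optimal_coding_rate_bounded[OF Z] by blast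
  show ?thesis
    unfolding KS_entropy_def
  proof (rule limsup_eq_lim)
    show "(\<lambda>x. real (length (Z (block n x))) / real n) \<in> borel_measurable M" for n
      by measurable
    show "real (length (Z (block n x))) / real n \<le> C" if "x \<in> space M" for n x
      using C(2)[OF block_in_lists[OF that, of n]] by simp
    show "AE x in M. limsup (\<lambda>n. ereal (real (length (Z (block n x))) / real n))
        \<le> ereal (part_entropy_n M T A r k / real k)" if k: "k \<ge> 1" for k
    proof -
      obtain f :: "nat \<Rightarrow> real" where f: "f \<longlonglongrightarrow> 0"
        "\<And>s. s \<in> lists {1..r} \<Longrightarrow> real (length (Z s)) / real (length s) \<le> emp_entropy r k s + f (length s)"
        using optimal_codingE[OF Z k] by blast
      from AE_emp_entropy_tendsto[of k] AE_space show ?thesis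
      proof eventually_elim
        case (elim x)
        have "(\<lambda>n. emp_entropy r k (block n x) + f n) \<longlonglongrightarrow> part_entropy_n M T A r k / real k"
          using tendsto_add[OF elim(1) f(1)] by simp
        then have "limsup (\<lambda>n. ereal (emp_entropy r k (block n x) + f n)) = ereal (part_entropy_n M T A r k / real k)"
          by (intro lim_imp_Limsup) auto
        moreover have "limsup (\<lambda>n. ereal (real (length (Z (block n x))) / real n))
            \<le> limsup (\<lambda>n. ereal (emp_entropy r k (block n x) + f n))"
          using f(2)[OF block_in_lists[OF elim(2)]] by (intro Limsup_mono always_eventually) auto
        ultimately show ?case by simp
      qed
    qed
    \<comment> \<open>Codewords of \<open>n\<close>-blocks have length at most \<open>N\<close>, so
      their Kraft sum is at most \<open>N + 1\<close>, hence at most \<open>C * real n + 2\<close>.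
      Gibbs' inequality then costs only the logarithm of this.\<close>
    show "part_entropy_n M T A r n / real n
        \<le> (\<integral>x. real (length (Z (block n x))) / real n \<partial>M) + log 2 (C * real n + 2) / real n"
      if n: "n \<ge> 1" for n
    proof -
      define N where "N = nat \<lfloor>C * real n\<rfloor>"
      have sub: "words r n \<subseteq> lists {1..r}"
        by (auto simp: words_def)
      have "length (Z w) \<le> N" if "w \<in> words r n" for w
      proof -
        have "real (length (Z w)) \<le> C * real n"
          using C(2)[of w] that sub n words_length[OF that] by (auto simp: field_simps)
        then show ?thesis unfolding N_def by (simp add: le_nat_floor)
      qed
      moreover have "inj_on Z (words r n)"
        using Z sub by (auto simp: optimal_coding_def intro: inj_on_subset)
      ultimately have "(\<Sum>w\<in>words r n. (1/2::real) ^ length (Z w)) \<le> real N + 1"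
        by (intro kraft_sum_le)
      also have "\<dots> \<le> C * real n + 2"
        using C(1) by (simp add: N_def) linarith
      finally have "part_entropy_n M T A r n
          \<le> (\<Sum>w\<in>words r n. measure M (cyl w) * real (length (Z w))) + log 2 (C * real n + 2)"
        unfolding part_entropy_n_def
        by (intro entropy_le_mean_length) (auto simp: sum_measure_cylinder)
      also have "(\<Sum>w\<in>words r n. measure M (cyl w) * real (length (Z w))) = (\<integral>x. real (length (Z (block n x))) \<partial>M)"
        by (rule integral_of_block[symmetric])
      finally show ?thesis
        by (simp add: divide_right_mono flip: add_divide_distrib)
    qed
    show "(\<lambda>n. log 2 (C * real n + 2) / real n) \<longlonglongrightarrow> 0"
    proof (cases "C = 0")
      case True
      then show ?thesis by (simp add: lim_const_over_n)
    next
      case False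
      with C(1) have "C > 0" by simp
      then show ?thesis by real_asymp
    qed
  qed auto
qed

end

theorem theorem4p2:
  fixes X :: "'a::metric_space set" and T :: "'a \<Rightarrow> 'a" and M :: "'a measure"
    and A :: "nat \<Rightarrow> 'a set" and r :: nat and Z :: "nat list \<Rightarrow> bool list"
  assumes "compact X"
    and "continuous_on X T" and "T ` X \<subseteq> X"
    and "prob_space M" and "sets M = sets (restrict_space borel X)"
    and "distr M M T = M"
    and "ergodic M T"
    and "\<forall>i\<in>{1..r}. A i \<in> sets M"
    and "\<forall>i\<in>{1..r}. \<forall>j\<in>{1..r}. i \<noteq> j \<longrightarrow> A i \<inter> A j = {}"
    and "(\<Union>i\<in>{1..r}. A i) = X"
    and "optimal_coding r Z"
  shows "AE x in M. K_Z Z T A r x = ereal (KS_entropy M T A r)"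
proof -
  have space: "space M = X"
    using sets_eq_imp_space_eq[OF assms(5)] by (simp add: space_restrict_space)
  \<comment> \<open>Continuity on \<open>X\<close> gives Borel measurability, and \<open>T\<close>
    maps \<open>X\<close> into itself; the sets of \<open>M\<close> are those of the restricted
    Borel space.\<close>
  have "T \<in> restrict_space borel X \<rightarrow>\<^sub>M restrict_space borel X"
    using borel_measurable_continuous_on_restrict[OF assms(2)] assms(3)
    by (intro measurable_restrict_space2) (auto simp: space_restrict_space)
  then have T: "T \<in> M \<rightarrow>\<^sub>M M"
    using measurable_cong_sets[OF assms(5) assms(5)] by blast
  interpret prob_space M by fact
  interpret coded_system M T A r
    by unfold_locales (use assms T space in auto)
  show ?thesis
    using AE_rate_eq_entropy[OF assms(11)] by (simp add: K_Z_def block_def)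
qed

end
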